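(* Let $\mathbb{K}$ be a field, let $I$ be a binomial ideal in $\mathbb{K}[\mathbf{x}]=\mathbb{K}[x_1,\dots,x_n]$ and let $\mathbf{x}^u-\mathbf{x}^{u'}$ be a binomial in $I$. If there is a binomial $\mathbf{x}^v-\mathbf{x}^{v'}\in I$ such that either both monomials $\mathbf{x}^v$ and $\mathbf{x}^{v'}$ divide $\mathbf{x}^u$ or both monomials $\mathbf{x}^v$ and $\mathbf{x}^{v'}$ divide $\mathbf{x}^{u'}$, then $\mathbf{x}^u-\mathbf{x}^{u'}$ does not belong to any reduced Gröbner basis for the ideal $I$.
   Context: All binomials are pure: the two monomials involved in a binomial are distinct and relatively prime. A binomial ideal is an ideal generated by binomials. "Any reduced Gröbner basis" means the reduced Gröbner basis of $I$ with respect to any monomial order on $\mathbb{N}_0^n$.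
   Formalization: The binomial x^v − x^v' is required to differ, up to sign, from x^u − x^u'; without this the claim fails for I = (x − 1) with u = v = 1, u' = v' = 0, where x − 1 is the reduced Gröbner basis. *)

theory Defs
  imports Complex_Main "HOL-Library.Poly_Mapping"
begin

text \<open>
  The polynomial ring \<open>K[x\<^sub>1,\<dots>,x\<^sub>n]\<close> is the type \<open>('n \<Rightarrow>\<^sub>0 nat) \<Rightarrow>\<^sub>0 'k\<close> with \<open>'k\<close> of class
  \<^class>\<open>field\<close> and \<open>'n\<close> of class \<^class>\<open>finite\<close>, where \<open>n = CARD('n)\<close>; exponent vectors have
  type \<open>'n \<Rightarrow>\<^sub>0 nat\<close>.
\<close>

definition xpow :: "('n::finite \<Rightarrow>\<^sub>0 nat) \<Rightarrow> (('n \<Rightarrow>\<^sub>0 nat) \<Rightarrow>\<^sub>0 'k::field)"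
  where "xpow u = Poly_Mapping.single u 1"

definition ideal_gen :: "'a::comm_ring_1 set \<Rightarrow> 'a set"
  where "ideal_gen B = module.span (*) B"

text \<open>
  This is what \<^const>\<open>coprime\<close> unfolds to; the library constant itself lives in
  \<^class>\<open>algebraic_semidom\<close>, of which \<open>'a \<Rightarrow>\<^sub>0 'b\<close> is not an instance.
\<close>

definition relatively_prime :: "'a::comm_semiring_1 \<Rightarrow> 'a \<Rightarrow> bool"
  where "relatively_prime a b \<longleftrightarrow> (\<forall>c. c dvd a \<longrightarrow> c dvd b \<longrightarrow> c dvd 1)"

text \<open>The condition on two monomials \<open>m\<close>, \<open>m'\<close> for \<open>m - m'\<close> to be a (pure) binomial.\<close>

definition pure_pair :: "'a::comm_ring_1 \<Rightarrow> 'a \<Rightarrow> bool"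
  where "pure_pair m m' \<longleftrightarrow> m \<noteq> m' \<and> relatively_prime m m'"

definition is_binomial :: "(('n::finite \<Rightarrow>\<^sub>0 nat) \<Rightarrow>\<^sub>0 'k::field) \<Rightarrow> bool"
  where "is_binomial p \<longleftrightarrow>
    (\<exists>u u'. pure_pair (xpow u :: ('n \<Rightarrow>\<^sub>0 nat) \<Rightarrow>\<^sub>0 'k) (xpow u') \<and> p = xpow u - xpow u')"

definition binomial_ideal :: "(('n::finite \<Rightarrow>\<^sub>0 nat) \<Rightarrow>\<^sub>0 'k::field) set \<Rightarrow> bool"
  where "binomial_ideal I \<longleftrightarrow> (\<exists>B. (\<forall>p\<in>B. is_binomial p) \<and> I = ideal_gen B)"

text \<open>
  By Dickson's lemma \<open>zero_least\<close> may equivalently be replaced by well-foundedness of \<open>lt\<close>.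
\<close>

locale monomial_order = linorder le lt
  for le :: "('n::finite \<Rightarrow>\<^sub>0 nat) \<Rightarrow> ('n \<Rightarrow>\<^sub>0 nat) \<Rightarrow> bool"
    and lt :: "('n \<Rightarrow>\<^sub>0 nat) \<Rightarrow> ('n \<Rightarrow>\<^sub>0 nat) \<Rightarrow> bool" +
  assumes zero_least: "le 0 s"
    and plus_mono: "le s t \<Longrightarrow> le (s + w) (t + w)"
begin

definition lead_exp :: "(('n \<Rightarrow>\<^sub>0 nat) \<Rightarrow>\<^sub>0 'k::field) \<Rightarrow> ('n \<Rightarrow>\<^sub>0 nat)"
  where "lead_exp p = Max (Poly_Mapping.keys p)"

definition initial_ideal :: "(('n \<Rightarrow>\<^sub>0 nat) \<Rightarrow>\<^sub>0 'k::field) set \<Rightarrow> (('n \<Rightarrow>\<^sub>0 nat) \<Rightarrow>\<^sub>0 'k) set"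
  where "initial_ideal S = ideal_gen {xpow (lead_exp p) | p. p \<in> S \<and> p \<noteq> 0}"

definition groebner_basis ::
    "(('n \<Rightarrow>\<^sub>0 nat) \<Rightarrow>\<^sub>0 'k::field) set \<Rightarrow> (('n \<Rightarrow>\<^sub>0 nat) \<Rightarrow>\<^sub>0 'k) set \<Rightarrow> bool"
  where "groebner_basis I G \<longleftrightarrow> finite G \<and> G \<subseteq> I \<and> initial_ideal G = initial_ideal I"

definition reduced_groebner_basis ::
    "(('n \<Rightarrow>\<^sub>0 nat) \<Rightarrow>\<^sub>0 'k::field) set \<Rightarrow> (('n \<Rightarrow>\<^sub>0 nat) \<Rightarrow>\<^sub>0 'k) set \<Rightarrow> bool"
  where "reduced_groebner_basis I G \<longleftrightarrow>
    groebner_basis I G \<and>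
    (\<forall>g\<in>G. g \<noteq> 0 \<and> Poly_Mapping.lookup g (lead_exp g) = 1) \<and>
    (\<forall>g\<in>G. \<forall>h\<in>G - {g}. \<forall>t\<in>Poly_Mapping.keys g.
      \<not> (xpow (lead_exp h) :: ('n \<Rightarrow>\<^sub>0 nat) \<Rightarrow>\<^sub>0 'k) dvd xpow t)"

end

end

theory Submission
  imports Defs
begin

text \<open>
  Let \<open>f\<close> be an element of a reduced Groebner basis \<open>G\<close> of \<open>I\<close>. If the leading monomial of a
  nonzero element \<open>p\<close> of \<open>I\<close> divides some term of \<open>f\<close>, then that term is the leading term of
  \<open>f\<close> and is equal to the leading monomial of \<open>p\<close>
  (\<open>reduced_groebner_basis_lead_dvd\<close>): some basis element has a leading monomial dividing that of
  \<open>p\<close>, hence dividing the term of \<open>f\<close>, and reducedness forces it to be \<open>f\<close> itself. The proof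
  applies this twice.

  Let \<open>f = \<plusminus>(x\<^sup>w - x\<^sup>w\<^sup>')\<close>, and suppose that \<open>x\<^sup>v\<close> and \<open>x\<^sup>v\<^sup>'\<close> both divide \<open>x\<^sup>w\<close>. With
  \<open>p = x\<^sup>v - x\<^sup>v\<^sup>'\<close>, whose leading monomial is \<open>x\<^sup>v\<close> by symmetry, the observation gives that
  \<open>x\<^sup>v = x\<^sup>w\<close> is the leading monomial of \<open>f\<close>. Then \<open>x\<^sup>v\<^sup>'\<close> divides \<open>x\<^sup>v\<close>, and being coprime to it,
  it is \<open>1\<close>. Thus \<open>I\<close> contains \<open>x\<^sup>w - 1\<close> and hence \<open>x\<^sup>w\<^sup>' - 1\<close>. The latter is nonzero because the
  two given binomials differ up to sign, and its leading monomial is \<open>x\<^sup>w\<^sup>'\<close>. The observation,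
  applied to \<open>p = x\<^sup>w\<^sup>' - 1\<close>, now makes \<open>x\<^sup>w\<^sup>'\<close> the leading monomial of \<open>f\<close> as well, a contradiction.
\<close>

lemma module_times: "module ((*) :: 'a::comm_ring_1 \<Rightarrow> 'a \<Rightarrow> 'a)"
  by unfold_locales (simp_all add: algebra_simps)

lemma ideal_gen_diff:
  assumes "p \<in> ideal_gen B" and "q \<in> ideal_gen B"
  shows "p - q \<in> ideal_gen B"
  using assms unfolding ideal_gen_def by (rule module.span_diff[OF module_times])

lemma xpow_dvd_iff:
  "(xpow a :: ('n::finite \<Rightarrow>\<^sub>0 nat) \<Rightarrow>\<^sub>0 'k::field) dvd xpow b \<longleftrightarrow> (\<exists>c. b = a + c)"
proof
  assume "(xpow a :: ('n \<Rightarrow>\<^sub>0 nat) \<Rightarrow>\<^sub>0 'k) dvd xpow b"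
  then obtain p :: "('n \<Rightarrow>\<^sub>0 nat) \<Rightarrow>\<^sub>0 'k" where p: "xpow b = xpow a * p"
    by (rule dvdE)
  have "b \<in> Poly_Mapping.keys (xpow a * p)"
    unfolding p[symmetric] by (simp add: xpow_def)
  then show "\<exists>c. b = a + c"
    using keys_mult[of "xpow a" p] by (auto simp: xpow_def)
next
  assume "\<exists>c. b = a + c"
  then show "(xpow a :: ('n \<Rightarrow>\<^sub>0 nat) \<Rightarrow>\<^sub>0 'k) dvd xpow b"
    by (auto simp: xpow_def mult_single intro: dvdI[where k = "Poly_Mapping.single _ 1"])
qed

lemma keys_xpow_diff:
  assumes "a \<noteq> b"
  shows "Poly_Mapping.keys (xpow a - xpow b :: ('n::finite \<Rightarrow>\<^sub>0 nat) \<Rightarrow>\<^sub>0 'k::field) = {a, b}"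
  using assms
  by (auto simp: in_keys_iff xpow_def lookup_minus lookup_single when_def split: if_splits)

lemma pure_pair_neq: "pure_pair (xpow a) (xpow b) \<Longrightarrow> a \<noteq> b"
  by (auto simp: pure_pair_def)

lemma pure_pair_dvd_imp_zero:
  assumes "pure_pair (xpow a :: ('n::finite \<Rightarrow>\<^sub>0 nat) \<Rightarrow>\<^sub>0 'k::field) (xpow b)"
    and "(xpow b :: ('n \<Rightarrow>\<^sub>0 nat) \<Rightarrow>\<^sub>0 'k) dvd xpow a"
  shows "b = 0"
proof -
  have "(xpow b :: ('n \<Rightarrow>\<^sub>0 nat) \<Rightarrow>\<^sub>0 'k) dvd xpow 0"
    using assms by (auto simp: pure_pair_def relatively_prime_def xpow_def)
  then obtain c where "0 = b + c"
    by (auto simp: xpow_dvd_iff)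
  then show "b = 0"
    by (intro poly_mapping_eqI) (metis add_is_0 lookup_add lookup_zero)
qed

text \<open>
  Polynomials all of whose terms are multiples of monomials from a fixed set form an ideal, so a
  monomial ideal cannot contain terms other than the obvious ones.
\<close>

lemma monomial_ideal_keys:
  fixes p :: "('n::finite \<Rightarrow>\<^sub>0 nat) \<Rightarrow>\<^sub>0 'k::field"
  assumes "p \<in> ideal_gen (xpow ` A)" and "t \<in> Poly_Mapping.keys p"
  shows "\<exists>a\<in>A. (xpow a :: ('n \<Rightarrow>\<^sub>0 nat) \<Rightarrow>\<^sub>0 'k) dvd xpow t"
proof -
  let ?M = "{t. \<exists>a\<in>A. (xpow a :: ('n \<Rightarrow>\<^sub>0 nat) \<Rightarrow>\<^sub>0 'k) dvd xpow t}"
  interpret module "(*) :: (('n \<Rightarrow>\<^sub>0 nat) \<Rightarrow>\<^sub>0 'k) \<Rightarrow> _"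
    by (rule module_times)
  have "Poly_Mapping.keys p \<subseteq> ?M"
    using assms(1) unfolding ideal_gen_def
  proof (induction rule: span_induct_alt)
    case base
    then show ?case by simp
  next
    case (step c x y)
    then obtain a where a: "a \<in> A" "x = xpow a" by blast
    have "Poly_Mapping.keys (c * x) \<subseteq> ?M"
    proof
      fix t assume "t \<in> Poly_Mapping.keys (c * x)"
      then obtain b where "t = b + a"
        using keys_mult[of c x] a(2) by (auto simp: xpow_def)
      then have "t = a + b" by (simp add: add.commute)
      then show "t \<in> ?M" using a(1) by (auto simp: xpow_dvd_iff)
    qed
    then show ?case
      using step.IH keys_add[of "c * x" y] by blast
  qed
  then show ?thesis using assms(2) by blast
qed

context monomial_order
begin

lemma xpow_dvd_imp_le:
  assumes "(xpow a :: ('n::finite \<Rightarrow>\<^sub>0 nat) \<Rightarrow>\<^sub>0 'k::field) dvd xpow b"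
  shows "le a b"
proof -
  obtain c where "b = a + c" using assms by (auto simp: xpow_dvd_iff)
  then show ?thesis using plus_mono[OF zero_least[of c], of a] by (simp add: add.commute)
qed

lemma lead_exp_in_keys: "p \<noteq> 0 \<Longrightarrow> lead_exp p \<in> Poly_Mapping.keys p"
  unfolding lead_exp_def by (rule Max_in) auto

lemma le_lead_exp: "t \<in> Poly_Mapping.keys p \<Longrightarrow> le t (lead_exp p)"
  unfolding lead_exp_def by (rule Max_ge) auto

lemma groebner_basis_lead_dvd:
  fixes p :: "('n \<Rightarrow>\<^sub>0 nat) \<Rightarrow>\<^sub>0 'k::field"
  assumes "groebner_basis I G" and "p \<in> I" and "p \<noteq> 0"
  shows "\<exists>h\<in>G. (xpow (lead_exp h) :: ('n \<Rightarrow>\<^sub>0 nat) \<Rightarrow>\<^sub>0 'k) dvd xpow (lead_exp p)"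
proof -
  have "xpow (lead_exp p) \<in> initial_ideal I"
    unfolding initial_ideal_def ideal_gen_def
    using assms(2,3) by (intro module.span_base[OF module_times]) blast
  also have "initial_ideal I = initial_ideal G"
    using assms(1) by (simp add: groebner_basis_def)
  also have "\<dots> = ideal_gen (xpow ` (lead_exp ` (G - {0})))"
    unfolding initial_ideal_def by (rule arg_cong[where f = ideal_gen]) blast
  finally have "\<exists>a\<in>lead_exp ` (G - {0}).
      (xpow a :: ('n \<Rightarrow>\<^sub>0 nat) \<Rightarrow>\<^sub>0 'k) dvd xpow (lead_exp p)"
    by (rule monomial_ideal_keys) (simp add: xpow_def)
  then show ?thesis by blast
qed

text \<open>
  Some \<open>h \<in> G\<close> has a leading monomial dividing that of \<open>p\<close>, hence dividing the term \<open>t\<close> of \<open>f\<close>;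
  by reducedness \<open>h = f\<close>. As divisibility refines the order and \<open>t\<close> is at most the leading
  exponent of \<open>f\<close>, the chain of divisibilities from \<open>lead_exp f\<close> over \<open>lead_exp p\<close> to \<open>t\<close>
  collapses.
\<close>

lemma reduced_groebner_basis_lead_dvd:
  fixes f p :: "('n \<Rightarrow>\<^sub>0 nat) \<Rightarrow>\<^sub>0 'k::field"
  assumes G: "reduced_groebner_basis I G" and f: "f \<in> G" "t \<in> Poly_Mapping.keys f"
    and p: "p \<in> I" "p \<noteq> 0"
    and dvd: "(xpow (lead_exp p) :: ('n \<Rightarrow>\<^sub>0 nat) \<Rightarrow>\<^sub>0 'k) dvd xpow t"
  shows "lead_exp p = t" and "lead_exp f = t"
proof -
  obtain h where h: "h \<in> G" "(xpow (lead_exp h) :: ('n \<Rightarrow>\<^sub>0 nat) \<Rightarrow>\<^sub>0 'k) dvd xpow (lead_exp p)"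
  proof -
    have "groebner_basis I G" using G by (simp add: reduced_groebner_basis_def)
    from groebner_basis_lead_dvd[OF this p] show ?thesis using that by blast
  qed
  have "h = f"
  proof (rule ccontr)
    assume "h \<noteq> f"
    then have "h \<in> G - {f}" using h(1) by simp
    then show False
      using G f dvd_trans[OF h(2) dvd] by (auto simp: reduced_groebner_basis_def)
  qed
  then have "le (lead_exp f) (lead_exp p)"
    using h(2) by (auto intro: xpow_dvd_imp_le)
  moreover have "le (lead_exp p) t"
    using dvd by (rule xpow_dvd_imp_le)
  moreover have "le t (lead_exp f)"
    using f(2) by (rule le_lead_exp)
  ultimately show "lead_exp p = t" and "lead_exp f = t"
    by (meson order.trans order.antisym)+
qed

text \<open>
  The hypotheses on \<open>f\<close> do not fix its sign, so that \<open>w\<close> may be either of the two exponents of a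
  binomial.
\<close>

lemma binomial_not_in_reduced_groebner_basis:
  fixes f :: "('n \<Rightarrow>\<^sub>0 nat) \<Rightarrow>\<^sub>0 'k::field"
  assumes G: "reduced_groebner_basis (ideal_gen B) G"
    and f: "Poly_Mapping.keys f = {w, w'}" "w \<noteq> w'" "xpow w - xpow w' \<in> ideal_gen B"
    and v: "pure_pair (xpow v :: ('n \<Rightarrow>\<^sub>0 nat) \<Rightarrow>\<^sub>0 'k) (xpow v')"
      "(xpow v - xpow v' :: ('n \<Rightarrow>\<^sub>0 nat) \<Rightarrow>\<^sub>0 'k) \<in> ideal_gen B" "{v, v'} \<noteq> {w, w'}"
    and dvd: "(xpow v :: ('n \<Rightarrow>\<^sub>0 nat) \<Rightarrow>\<^sub>0 'k) dvd xpow w"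
      "(xpow v' :: ('n \<Rightarrow>\<^sub>0 nat) \<Rightarrow>\<^sub>0 'k) dvd xpow w"
  shows "f \<notin> G"
proof
  assume "f \<in> G"
  note lead = reduced_groebner_basis_lead_dvd[OF G \<open>f \<in> G\<close>]
  let ?X = "xpow :: _ \<Rightarrow> ('n \<Rightarrow>\<^sub>0 nat) \<Rightarrow>\<^sub>0 'k"
  have keys: "Poly_Mapping.keys (?X v - ?X v') = {v, v'}"
    using pure_pair_neq[OF v(1)] by (rule keys_xpow_diff)
  then have nz: "?X v - ?X v' \<noteq> 0" by auto
  have mem: "lead_exp (?X v - ?X v') \<in> {v, v'}"
    using lead_exp_in_keys[OF nz] keys by simp
  have lead_eq: "lead_exp (?X v - ?X v') = w" "lead_exp f = w"
    using lead[of w, OF _ v(2) nz] mem dvd f(1) by auto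
  \<comment> \<open>The other monomial divides \<open>w\<close>, to which it is coprime, so it is \<open>1\<close>.\<close>
  have v_sym: "pure_pair (?X v') (?X v)"
    using v(1) by (auto simp: pure_pair_def relatively_prime_def)
  have cases: "v = w \<and> v' = 0 \<or> v' = w \<and> v = 0"
    using mem lead_eq(1) dvd pure_pair_dvd_imp_zero[OF v(1)] pure_pair_dvd_imp_zero[OF v_sym]
    by auto
  have "0 \<in> ideal_gen B"
    unfolding ideal_gen_def by (rule module.span_zero[OF module_times])
  then have "?X w - ?X 0 \<in> ideal_gen B"
    using cases v(2) ideal_gen_diff[of 0 B "?X v - ?X v'"] by auto
  then have I': "?X w' - ?X 0 \<in> ideal_gen B"
    using ideal_gen_diff[OF _ f(3)] by fastforce
  \<comment> \<open>If \<open>w'\<close> were \<open>0\<close>, both binomials would be \<open>x\<^sup>w - 1\<close> up to sign, which may well belong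
    to a reduced basis.\<close>
  have "w' \<noteq> 0" using cases v(3) by auto
  then have keys': "Poly_Mapping.keys (?X w' - ?X 0) = {w', 0}"
    by (rule keys_xpow_diff)
  then have nz': "?X w' - ?X 0 \<noteq> 0" by auto
  have "lead_exp (?X w' - ?X 0) = w'"
    using lead_exp_in_keys[OF nz'] le_lead_exp[of w' "?X w' - ?X 0"] keys'
      zero_least[of w'] order.antisym by auto
  then have "lead_exp f = w'"
    using lead(2)[of w', OF _ I' nz'] f(1) by simp
  with lead_eq(2) \<open>w \<noteq> w'\<close> show False by simp
qed

end

theorem lemma5p1:
  fixes I :: "(('n::finite \<Rightarrow>\<^sub>0 nat) \<Rightarrow>\<^sub>0 'k::field) set"
    and u u' :: "'n \<Rightarrow>\<^sub>0 nat"
  assumes "binomial_ideal I"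
    and "pure_pair (xpow u :: ('n \<Rightarrow>\<^sub>0 nat) \<Rightarrow>\<^sub>0 'k) (xpow u')"
    and "xpow u - xpow u' \<in> I"
    and "\<exists>v v'. pure_pair (xpow v :: ('n \<Rightarrow>\<^sub>0 nat) \<Rightarrow>\<^sub>0 'k) (xpow v') \<and>
           xpow v - xpow v' \<in> I \<and>
           {v, v'} \<noteq> {u, u'} \<and>
           (((xpow v :: ('n \<Rightarrow>\<^sub>0 nat) \<Rightarrow>\<^sub>0 'k) dvd xpow u \<and>
             (xpow v' :: ('n \<Rightarrow>\<^sub>0 nat) \<Rightarrow>\<^sub>0 'k) dvd xpow u) \<or>
            ((xpow v :: ('n \<Rightarrow>\<^sub>0 nat) \<Rightarrow>\<^sub>0 'k) dvd xpow u' \<and>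
             (xpow v' :: ('n \<Rightarrow>\<^sub>0 nat) \<Rightarrow>\<^sub>0 'k) dvd xpow u'))"
  shows "\<forall>le lt G. monomial_order le lt \<longrightarrow>
           monomial_order.reduced_groebner_basis le I G \<longrightarrow>
           xpow u - xpow u' \<notin> G"
proof (intro allI impI)
  fix le lt :: "('n \<Rightarrow>\<^sub>0 nat) \<Rightarrow> ('n \<Rightarrow>\<^sub>0 nat) \<Rightarrow> bool"
    and G :: "(('n \<Rightarrow>\<^sub>0 nat) \<Rightarrow>\<^sub>0 'k) set"
  assume "monomial_order le lt" and G: "monomial_order.reduced_groebner_basis le I G"
  then interpret monomial_order le lt by simp
  obtain B where I: "I = ideal_gen B"
    using assms(1) by (auto simp: binomial_ideal_def)
  note G = G[unfolded I]
  have "u \<noteq> u'" using assms(2) by (rule pure_pair_neq)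
  then have keys: "Poly_Mapping.keys (xpow u - xpow u' :: ('n \<Rightarrow>\<^sub>0 nat) \<Rightarrow>\<^sub>0 'k) = {u, u'}"
    by (rule keys_xpow_diff)
  then have keys': "Poly_Mapping.keys (xpow u - xpow u' :: ('n \<Rightarrow>\<^sub>0 nat) \<Rightarrow>\<^sub>0 'k) = {u', u}"
    by (simp add: insert_commute)
  have mem: "xpow u - xpow u' \<in> ideal_gen B" using assms(3) I by simp
  then have mem': "xpow u' - xpow u \<in> ideal_gen B"
    using ideal_gen_diff[OF ideal_gen_diff[OF mem mem] mem] by simp
  obtain v v' where v: "pure_pair (xpow v :: ('n \<Rightarrow>\<^sub>0 nat) \<Rightarrow>\<^sub>0 'k) (xpow v')"
      "(xpow v - xpow v' :: ('n \<Rightarrow>\<^sub>0 nat) \<Rightarrow>\<^sub>0 'k) \<in> ideal_gen B" "{v, v'} \<noteq> {u, u'}"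
    and dvd: "((xpow v :: ('n \<Rightarrow>\<^sub>0 nat) \<Rightarrow>\<^sub>0 'k) dvd xpow u \<and>
             (xpow v' :: ('n \<Rightarrow>\<^sub>0 nat) \<Rightarrow>\<^sub>0 'k) dvd xpow u) \<or>
            ((xpow v :: ('n \<Rightarrow>\<^sub>0 nat) \<Rightarrow>\<^sub>0 'k) dvd xpow u' \<and>
             (xpow v' :: ('n \<Rightarrow>\<^sub>0 nat) \<Rightarrow>\<^sub>0 'k) dvd xpow u')"
    using assms(4) I by blast
  have v3': "{v, v'} \<noteq> {u', u}" using v(3) by (simp add: insert_commute)
  from dvd show "xpow u - xpow u' \<notin> G"
    using binomial_not_in_reduced_groebner_basis[OF G keys \<open>u \<noteq> u'\<close> mem v]
      binomial_not_in_reduced_groebner_basis[OF G keys' \<open>u \<noteq> u'\<close>[symmetric] mem' v(1,2) v3']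
    by blast
qed

end
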